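(* Let $S\in\mathbb{R}^{d_S}$, $Y\in\mathbb{R}^{d_Y}$ and $W\in\mathbb{R}^{d}$ be random vectors, and let $S_Y=T(S,Y)$ be the solution of the optimal transport barycenter problem for $S\mid Y$ with quadratic cost. If $W$ is conditionally independent of $S$ given $Y$, then $W$ is independent of $S_Y$.
   Context: All random vectors are defined on a common probability space. The (Monge) optimal transport barycenter problem for $S\mid Y$ with quadratic cost is $$\min_{U}\ \mathbb{E}\big[\|S-U\|^2\big]\quad\text{over all random vectors of the form } U=\tilde T(S,Y)\in\mathbb{R}^{d_S},\ \tilde T \text{ measurable, such that } U \text{ is independent of } Y.$$ $S_Y=T(S,Y)$ denotes a minimizer (assumed to exist). "$W$ is conditionally independent of $S$ given $Y$" means $\mathbb{E}[g(W)h(S)\mid Y]=\mathbb{E}[g(W)\mid Y]\,\mathbb{E}[h(S)\mid Y]$ almost surely for all bounded measurable real functions $g,h$. *)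

theory Defs
  imports "HOL-Probability.Probability"
begin

text \<open>
  The library's \<^const>\<open>prob_space.indep_var\<close> forces both random variables to have the same value
  type. Hence independence of random vectors of possibly different dimensions is defined here as
  independence (\<^const>\<open>prob_space.indep_set\<close>) of the sigma-algebras they generate; on a common value
  type this is \<open>indep_var\<close>, as the lemma shows.
\<close>

definition indep_rv ::
    "'w measure \<Rightarrow> ('w \<Rightarrow> 'a::euclidean_space) \<Rightarrow> ('w \<Rightarrow> 'b::euclidean_space) \<Rightarrow> bool"
  where "indep_rv M X Y \<longleftrightarrow> X \<in> borel_measurable M \<and> Y \<in> borel_measurable M \<and>
    prob_space.indep_set M (sets (vimage_algebra (space M) X borel))
      (sets (vimage_algebra (space M) Y borel))"

lemma (in prob_space) indep_rv_iff_indep_var: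
  "indep_rv M X Y \<longleftrightarrow> indep_var borel X borel Y"
  unfolding indep_rv_def indep_var_eq vimage_algebra_def
  by (subst (1 2) sets_measure_of) auto

text \<open>
  Cost and feasible set of the Monge optimal transport barycenter problem for \<open>S | Y\<close>.
  The cost \<open>E[|S - U|^2]\<close> is an extended nonnegative real, so no integrability of \<open>S\<close> or \<open>U\<close>
  is presupposed and a non-integrable cost counts as \<open>\<infinity>\<close> (a Bochner integral would make it \<open>0\<close>).
\<close>

definition barycenter_cost :: "'w measure \<Rightarrow> ('w \<Rightarrow> 'a::euclidean_space) \<Rightarrow> ('w \<Rightarrow> 'a) \<Rightarrow> ennreal"
  where "barycenter_cost M S U = (\<integral>\<^sup>+ \<omega>. ennreal ((norm (S \<omega> - U \<omega>))\<^sup>2) \<partial>M)"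

definition barycenter_feasible ::
    "'w measure \<Rightarrow> ('w \<Rightarrow> 'a::euclidean_space) \<Rightarrow> ('w \<Rightarrow> 'b::euclidean_space) \<Rightarrow> ('w \<Rightarrow> 'a) set"
  where "barycenter_feasible M S Y =
    {U. (\<exists>T \<in> borel \<Otimes>\<^sub>M borel \<rightarrow>\<^sub>M borel. U = (\<lambda>\<omega>. T (S \<omega>, Y \<omega>))) \<and>
        indep_rv M U Y}"

definition ot_barycenter ::
    "'w measure \<Rightarrow> ('w \<Rightarrow> 'a::euclidean_space) \<Rightarrow> ('w \<Rightarrow> 'b::euclidean_space) \<Rightarrow> ('w \<Rightarrow> 'a) \<Rightarrow> bool"
  where "ot_barycenter M S Y U \<longleftrightarrow>
    is_arg_min (barycenter_cost M S) (\<lambda>V. V \<in> barycenter_feasible M S Y) U"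

text \<open>
  Conditional expectation given \<open>Y\<close> is \<^const>\<open>real_cond_exp\<close> with respect to the sigma-algebra
  generated by \<open>Y\<close>.
\<close>

definition cond_indep_given ::
    "'w measure \<Rightarrow> ('w \<Rightarrow> 'c::euclidean_space) \<Rightarrow> ('w \<Rightarrow> 'a::euclidean_space) \<Rightarrow>
      ('w \<Rightarrow> 'b::euclidean_space) \<Rightarrow> bool"
  where "cond_indep_given M W S Y \<longleftrightarrow>
    (\<forall>(g :: 'c \<Rightarrow> real) \<in> borel_measurable borel. \<forall>(h :: 'a \<Rightarrow> real) \<in> borel_measurable borel.
      bounded (range g) \<longrightarrow> bounded (range h) \<longrightarrow>
      (let F = vimage_algebra (space M) Y borel in
        AE \<omega> in M. real_cond_exp M F (\<lambda>x. g (W x) * h (S x)) \<omega> =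
          real_cond_exp M F (\<lambda>x. g (W x)) \<omega> * real_cond_exp M F (\<lambda>x. h (S x)) \<omega>))"

end

theory Submission
  imports Defs
begin

text \<open>
  Since \<open>S\<^sub>Y\<close> is a function of \<open>(S, Y)\<close>, conditional independence gives
  \<open>P(W \<in> A, S\<^sub>Y \<in> B) = E[P(W \<in> A | Y) 1(S\<^sub>Y \<in> B)]\<close>, and the right-hand side factorizes because
  \<open>S\<^sub>Y\<close> is independent of \<open>Y\<close>.
\<close>

text \<open>Dynkin's pi-lambda argument: the sets \<open>C\<close> whose preimage under
  \<open>Z\<close> carries zero integral are closed under disjoint countable unions and, once the
  total integral vanishes, under complements. Since \<open>f\<close> may change sign or be
  vector-valued, this takes the place of uniqueness of measures on a generator.\<close>

lemma set_integral_eq_0_Int_stable: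
  fixes f :: "'a \<Rightarrow> 'b::{banach, second_countable_topology}"
  assumes f: "integrable M f" and Z: "Z \<in> M \<rightarrow>\<^sub>M N"
    and G: "Int_stable G" "G \<subseteq> Pow (space N)" "space N \<in> G" "sets N = sigma_sets (space N) G"
    and eq: "\<And>C. C \<in> G \<Longrightarrow> (LINT x:(Z -` C \<inter> space M)|M. f x) = 0"
    and C: "C \<in> sets N"
  shows "(LINT x:(Z -` C \<inter> space M)|M. f x) = 0"
  using G(1,2) C[unfolded G(4)]
proof (induction rule: sigma_sets_induct_disjoint)
  case (basic C)
  then show ?case by (rule eq)
next
  case empty
  show ?case by (simp add: set_lebesgue_integral_def)
next
  case (compl C)
  have [measurable]: "Z -` C \<inter> space M \<in> sets M"
    using compl(1) G(4) measurable_sets[OF Z] by auto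
  have [simp]: "set_integrable M B f" if "B \<in> sets M" for B
    unfolding set_integrable_def by (rule integrable_mult_indicator[OF that f])
  have *: "Z -` (space N - C) \<inter> space M = space M - (Z -` C \<inter> space M)"
    using measurable_space[OF Z] by auto
  \<comment> \<open>This is where \<open>space N \<in> G\<close> enters: the total integral is zero,
    so the integral over a complement is minus the integral over the set.\<close>
  have "(LINT x:space M|M. f x) = (LINT x:(Z -` (space N) \<inter> space M)|M. f x)"
    using measurable_space[OF Z] by (intro arg_cong[where f="\<lambda>B. LINT x:B|M. f x"]) auto
  then have "(LINT x:space M|M. f x) = 0" using eq[OF G(3)] by simp
  moreover have "(LINT x:(space M - Z -` C \<inter> space M) \<union> (Z -` C \<inter> space M)|M. f x)
      = (LINT x:(space M - Z -` C \<inter> space M)|M. f x) + (LINT x:(Z -` C \<inter> space M)|M. f x)"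
    by (intro set_integral_Un) auto
  moreover have "(space M - Z -` C \<inter> space M) \<union> (Z -` C \<inter> space M) = space M" by auto
  ultimately show ?case using compl(2) by (simp add: *)
next
  case (union A)
  have meas: "Z -` A i \<inter> space M \<in> sets M" for i
    using union(2) G(4) measurable_sets[OF Z] by auto
  have *: "Z -` (\<Union>i. A i) \<inter> space M = (\<Union>i. Z -` A i \<inter> space M)" by auto
  have "(LINT x:(\<Union>i. Z -` A i \<inter> space M)|M. f x) = (\<Sum>i. (LINT x:(Z -` A i \<inter> space M)|M. f x))"
  proof (rule lebesgue_integral_countable_add)
    show "set_integrable M (\<Union>i. Z -` A i \<inter> space M) f"
      unfolding set_integrable_def by (intro integrable_mult_indicator sets.countable_UN f) (use meas in blast)
  qed (use meas union(1) in \<open>auto simp: disjoint_family_on_def\<close>)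
  then show ?case using union(3) by (simp add: *)
qed

lemma (in prob_space) finite_measure_subalgebra_vimage:
  assumes "Y \<in> borel_measurable M"
  shows "finite_measure_subalgebra M (vimage_algebra (space M) Y borel)"
  by unfold_locales
    (use assms in \<open>auto simp: subalgebra_def sets_vimage_algebra2 in_vimage_algebra intro: measurable_sets\<close>)

text \<open>Integrated form of \<open>P(W \<in> A | S, Y) = P(W \<in> A | Y)\<close>. Conditional
  independence is formulated with functions of \<open>S\<close> alone; testing against all events of
  the pair \<open>(S, Y)\<close> is what makes it applicable to functions of both variables.\<close>

lemma (in prob_space) cond_indep_given_set_integral:
  fixes W :: "'a \<Rightarrow> 'c::euclidean_space" and S :: "'a \<Rightarrow> 'd::euclidean_space"
    and Y :: "'a \<Rightarrow> 'e::euclidean_space"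
  defines "F \<equiv> vimage_algebra (space M) Y borel"
  assumes S[measurable]: "S \<in> borel_measurable M" and Y[measurable]: "Y \<in> borel_measurable M"
    and W[measurable]: "W \<in> borel_measurable M"
    and ci: "cond_indep_given M W S Y"
    and A[measurable]: "A \<in> sets borel" and C: "C \<in> sets (borel \<Otimes>\<^sub>M borel)"
  shows "(LINT x:((\<lambda>x. (S x, Y x)) -` C \<inter> space M)|M.
      indicator A (W x) - real_cond_exp M F (\<lambda>x. indicator A (W x)) x) = 0"
proof -
  interpret finite_measure_subalgebra M F
    unfolding F_def by (rule finite_measure_subalgebra_vimage[OF Y])
  define f :: "'a \<Rightarrow> real" where "f = (\<lambda>x. indicator A (W x))"
  have f[measurable]: "f \<in> borel_measurable M" unfolding f_def by measurable
  have fi: "integrable M f"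
    by (rule integrable_const_bound[where B=1]) (auto simp: f_def indicator_def)
  define k where "k = real_cond_exp M F f"
  have ki: "integrable M k" unfolding k_def by (rule real_cond_exp_int[OF fi])
  have kF[measurable]: "k \<in> borel_measurable F" unfolding k_def by simp
  have kM[measurable]: "k \<in> borel_measurable M" unfolding k_def by simp
  \<comment> \<open>The two sides of a rectangle are handled differently: \<open>B\<close> becomes
    the factor \<open>h\<close> and is treated by conditional independence, while \<open>D\<close>
    becomes an event \<open>E\<close> of \<open>F\<close> and is treated by the defining property of
    conditional expectation.\<close>
  have rect: "(LINT x:((\<lambda>x. (S x, Y x)) -` (B \<times> D) \<inter> space M)|M. f x - k x) = 0"
    if B[measurable]: "B \<in> sets borel" and D[measurable]: "D \<in> sets borel" for B D
  proof -
    define h :: "'a \<Rightarrow> real" where "h = (\<lambda>x. indicator B (S x))"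
    have h[measurable]: "h \<in> borel_measurable M" unfolding h_def by measurable
    have hb: "\<bar>h x\<bar> \<le> 1" for x by (simp add: h_def indicator_def)
    have hi: "integrable M h"
      by (rule integrable_const_bound[where B=1]) (use hb in auto)
    have fhi: "integrable M (\<lambda>x. f x * h x)"
      by (rule integrable_const_bound[where B=1]) (auto simp: f_def h_def indicator_def)
    \<comment> \<open>Domination by \<open>k\<close> itself suffices, as \<open>h\<close> is bounded
      by 1; no pointwise bound on \<open>k\<close> is needed.\<close>
    have khi: "integrable M (\<lambda>x. k x * h x)"
      using ki by (rule Bochner_Integration.integrable_bound)
        (use hb in \<open>auto simp: abs_mult intro!: mult_left_le\<close>)
    define E where "E = Y -` D \<inter> space M"
    have E: "E \<in> sets F" unfolding E_def F_def by (rule in_vimage_algebra[OF D])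
    have EM: "E \<in> sets M" using E subalg unfolding subalgebra_def by auto
    have "AE x in M. real_cond_exp M F (\<lambda>x. f x * h x) x =
        k x * real_cond_exp M F h x"
    proof -
      have "bounded (range (indicator A :: 'c \<Rightarrow> real))" "bounded (range (indicator B :: 'd \<Rightarrow> real))"
        by (auto intro!: boundedI[where B=1] simp: indicator_def)
      then show ?thesis
        using ci[unfolded cond_indep_given_def Let_def, rule_format,
          of "indicator A" "indicator B"]
        by (simp add: f_def h_def k_def F_def)
    qed
    \<comment> \<open>Pulling out the \<open>F\<close>-measurable factor \<open>k\<close> yields the
      same product as conditional independence did, so \<open>f * h\<close> and \<open>k * h\<close>
      have equal conditional expectations and hence equal integrals over \<open>E\<close>.\<close>
    moreover have "AE x in M. real_cond_exp M F (\<lambda>x. k x * h x) x =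
        k x * real_cond_exp M F h x"
      by (rule real_cond_exp_mult[OF kF h khi])
    ultimately have ae: "AE x in M. real_cond_exp M F (\<lambda>x. f x * h x) x =
        real_cond_exp M F (\<lambda>x. k x * h x) x" by eventually_elim simp
    have "(LINT x:E|M. f x * h x) = (LINT x:E|M. real_cond_exp M F (\<lambda>x. f x * h x) x)"
      by (rule real_cond_exp_intA[OF fhi E])
    also have "\<dots> = (LINT x:E|M. real_cond_exp M F (\<lambda>x. k x * h x) x)"
      by (rule set_lebesgue_integral_cong_AE) (use EM ae in auto)
    also have "\<dots> = (LINT x:E|M. k x * h x)"
      by (rule real_cond_exp_intA[OF khi E, symmetric])
    finally have eq: "(LINT x:E|M. f x * h x) = (LINT x:E|M. k x * h x)" .
    have "(LINT x:((\<lambda>x. (S x, Y x)) -` (B \<times> D) \<inter> space M)|M. f x - k x)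
        = (LINT x:E|M. f x * h x - k x * h x)"
      unfolding set_lebesgue_integral_def
      by (rule Bochner_Integration.integral_cong) (auto simp: E_def h_def indicator_def)
    also have "\<dots> = (LINT x:E|M. f x * h x) - (LINT x:E|M. k x * h x)"
      by (rule set_integral_diff)
        (unfold set_integrable_def, (rule integrable_mult_indicator[OF EM], fact)+)
    finally show ?thesis using eq by simp
  qed
  have "(LINT x:((\<lambda>x. (S x, Y x)) -` C \<inter> space M)|M. f x - k x) = 0"
  \<comment> \<open>Measurable rectangles are stable under intersection, contain the whole space and
    generate the product sigma-algebra.\<close>
  proof (rule set_integral_eq_0_Int_stable[where N="borel \<Otimes>\<^sub>M borel" and
      G="{B \<times> D |B D. B \<in> sets borel \<and> D \<in> sets borel}"])
    show "Int_stable {B \<times> D |B D. B \<in> sets (borel :: 'd measure) \<and> D \<in> sets (borel :: 'e measure)}"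
      by (rule Int_stable_pair_measure_generator)
    show "space (borel \<Otimes>\<^sub>M borel) \<in>
        {B \<times> D |B D. B \<in> sets (borel :: 'd measure) \<and> D \<in> sets (borel :: 'e measure)}"
      unfolding space_pair_measure by blast
  qed (use fi ki rect C in \<open>auto simp: sets_pair_measure space_pair_measure\<close>)
  then show ?thesis by (simp add: f_def k_def)
qed

text \<open>The constant is trivially measurable for the sigma-algebra of \<open>Y\<close>, and by
  independence it has the right integral over each event \<open>E\<close> of that sigma-algebra.
  These two properties characterize the conditional expectation almost surely.\<close>

lemma (in prob_space) indep_rv_real_cond_exp_indicator:
  fixes U :: "'a \<Rightarrow> 'c::euclidean_space" and Y :: "'a \<Rightarrow> 'e::euclidean_space"
  assumes ind: "indep_rv M U Y" and B: "B \<in> sets borel"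
  shows "AE x in M. real_cond_exp M (vimage_algebra (space M) Y borel) (\<lambda>x. indicator B (U x)) x
    = prob (U -` B \<inter> space M)"
proof -
  let ?F = "vimage_algebra (space M) Y borel"
  have U[measurable]: "U \<in> borel_measurable M" and Y: "Y \<in> borel_measurable M"
    and ind_sets: "indep_set (sets (vimage_algebra (space M) U borel)) (sets ?F)"
    using ind by (auto simp: indep_rv_def)
  note [measurable] = B
  interpret finite_measure_subalgebra M ?F
    by (rule finite_measure_subalgebra_vimage[OF Y])
  have UB: "U -` B \<inter> space M \<in> sets M" by measurable
  show ?thesis
  proof (rule real_cond_exp_charact)
    fix E assume E: "E \<in> sets ?F"
    then have EM: "E \<in> sets M" using subalg unfolding subalgebra_def by auto
    have "(LINT x:E|M. indicator B (U x)) = (LINT x|M. indicator (U -` B \<inter> space M \<inter> E) x :: real)"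
      unfolding set_lebesgue_integral_def
      by (rule Bochner_Integration.integral_cong) (auto simp: indicator_def)
    also have "\<dots> = prob (U -` B \<inter> space M \<inter> E)" using UB EM by simp
    also have "\<dots> = prob (U -` B \<inter> space M) * prob E"
      by (rule indep_setD[OF ind_sets in_vimage_algebra[OF B] E])
    also have "\<dots> = (LINT x:E|M. prob (U -` B \<inter> space M))"
      using EM by (simp add: set_lebesgue_integral_def)
    finally show "(LINT x:E|M. indicator B (U x)) = (LINT x:E|M. prob (U -` B \<inter> space M))" .
  next
    show "integrable M (\<lambda>x. indicator B (U x) :: real)"
      by (rule integrable_const_bound[where B=1]) (auto simp: indicator_def)
  qed auto
qed

theorem lemma4:
  fixes M :: "'w measure"
    and S :: "'w \<Rightarrow> real ^ 'dS"
    and Y :: "'w \<Rightarrow> real ^ 'dY"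
    and W :: "'w \<Rightarrow> real ^ 'd"
    and T :: "(real ^ 'dS) \<times> (real ^ 'dY) \<Rightarrow> real ^ 'dS"
    and S\<^sub>Y :: "'w \<Rightarrow> real ^ 'dS"
  assumes "prob_space M"
    and "S \<in> borel_measurable M"
    and "Y \<in> borel_measurable M"
    and "W \<in> borel_measurable M"
    and "T \<in> borel \<Otimes>\<^sub>M borel \<rightarrow>\<^sub>M borel"
    and "S\<^sub>Y = (\<lambda>\<omega>. T (S \<omega>, Y \<omega>))"
    and "ot_barycenter M S Y S\<^sub>Y"
    and "cond_indep_given M W S Y"
  shows "indep_rv M W S\<^sub>Y"
proof -
  interpret prob_space M by fact
  let ?F = "vimage_algebra (space M) Y borel"
  interpret finite_measure_subalgebra M ?F
    by (rule finite_measure_subalgebra_vimage) fact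
  \<comment> \<open>A minimizer is in particular feasible, and feasibility contains this
    independence.\<close>
  have ind: "indep_rv M S\<^sub>Y Y"
    using assms(7) by (simp add: ot_barycenter_def is_arg_min_def barycenter_feasible_def)
  note [measurable] = assms(2-5)
  have SY[measurable]: "S\<^sub>Y \<in> borel_measurable M" using ind by (simp add: indep_rv_def)
  have prod: "prob (W -` A \<inter> space M \<inter> (S\<^sub>Y -` B \<inter> space M))
      = prob (W -` A \<inter> space M) * prob (S\<^sub>Y -` B \<inter> space M)"
    if A[measurable]: "A \<in> sets borel" and B[measurable]: "B \<in> sets borel" for A B
  proof -
    define f :: "'w \<Rightarrow> real" where "f = (\<lambda>x. indicator A (W x))"
    define u :: "'w \<Rightarrow> real" where "u = (\<lambda>x. indicator B (S\<^sub>Y x))"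
    define k where "k = real_cond_exp M ?F f"
    have [measurable]: "f \<in> borel_measurable M" "u \<in> borel_measurable M"
      unfolding f_def u_def by measurable
    have fi: "integrable M f"
      by (rule integrable_const_bound[where B=1]) (auto simp: f_def indicator_def)
    have ki: "integrable M k" unfolding k_def by (rule real_cond_exp_int[OF fi])
    have kF[measurable]: "k \<in> borel_measurable ?F" unfolding k_def by simp
    have kM[measurable]: "k \<in> borel_measurable M" unfolding k_def by simp
    have fui: "integrable M (\<lambda>x. f x * u x)"
      by (rule integrable_const_bound[where B=1]) (auto simp: f_def u_def indicator_def)
    have kui: "integrable M (\<lambda>x. k x * u x)"
      using ki by (rule Bochner_Integration.integrable_bound) (auto simp: u_def indicator_def)
    \<comment> \<open>The event \<open>S\<^sub>Y \<in> B\<close> is the event that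
      \<open>(S, Y)\<close> lies in this set.\<close>
    have TB: "T -` B \<in> sets (borel \<Otimes>\<^sub>M borel)"
      using measurable_sets[OF assms(5) B] by (simp add: space_pair_measure)
    have "(LINT x|M. f x * u x) - (LINT x|M. k x * u x) = (LINT x|M. f x * u x - k x * u x)"
      using fui kui by simp
    also have "\<dots> = (LINT x:((\<lambda>x. (S x, Y x)) -` (T -` B) \<inter> space M)|M. f x - k x)"
      unfolding set_lebesgue_integral_def
      by (rule Bochner_Integration.integral_cong) (auto simp: u_def assms(6) indicator_def)
    also have "\<dots> = 0"
      using cond_indep_given_set_integral[OF assms(2-4,8) A TB] by (simp add: f_def k_def)
    finally have "(LINT x|M. f x * u x) = (LINT x|M. k x * u x)" by simp
    \<comment> \<open>As \<open>k\<close> is \<open>?F\<close>-measurable, \<open>u\<close> may be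
      replaced by its conditional expectation, which is almost surely constant because
      \<open>S\<^sub>Y\<close> is independent of \<open>Y\<close>.\<close>
    also have "\<dots> = (LINT x|M. k x * real_cond_exp M ?F u x)"
      by (rule real_cond_exp_intg(2)[symmetric]) (use kui in auto)
    also have "\<dots> = (LINT x|M. k x * prob (S\<^sub>Y -` B \<inter> space M))"
      by (rule integral_cong_AE)
        (use indep_rv_real_cond_exp_indicator[OF ind B] in \<open>auto simp: u_def\<close>)
    also have "\<dots> = (LINT x|M. f x) * prob (S\<^sub>Y -` B \<inter> space M)"
      using real_cond_exp_int(2)[OF fi] by (simp add: k_def)
    \<comment> \<open>From here the chain substitutes inside the equation obtained so far: first the
      factor on its right, then its left-hand side.\<close>
    also have "(LINT x|M. f x) = (LINT x|M. indicator (W -` A \<inter> space M) x)"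
      by (rule Bochner_Integration.integral_cong) (auto simp: f_def indicator_def)
    also have "\<dots> = prob (W -` A \<inter> space M)" by simp
    also have "(LINT x|M. f x * u x)
        = (LINT x|M. indicator (W -` A \<inter> space M \<inter> (S\<^sub>Y -` B \<inter> space M)) x)"
      by (rule Bochner_Integration.integral_cong) (auto simp: f_def u_def indicator_def)
    also have "\<dots> = prob (W -` A \<inter> space M \<inter> (S\<^sub>Y -` B \<inter> space M))"
      by (subst Bochner_Integration.integral_indicator) (auto intro!: arg_cong[where f=prob])
    finally show ?thesis .
  qed
  \<comment> \<open>The generated sigma-algebras consist exactly of the preimages of Borel sets, so
    \<open>prod\<close> covers every pair of events.\<close>
  show ?thesis
    unfolding indep_rv_def indep_sets2_eq
    using prod assms(4) SY
    by (auto simp: sets_vimage_algebra2 intro: measurable_sets)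
qed

end
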